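(* For every integer $c\ge 7$ we have $\delta_1(c)\le \frac{c^2+6c-5}{4}$.
   Context: An embedded graph is a connected graph together with a combinatorial embedding in an orientable surface: every edge $\{v,w\}$ is regarded as two directed edges $(v,w)$ and $(w,v)$, and for every vertex $v$ the directed edges $(v,\cdot)$ are given a cyclic (rotational) order. A face is a cyclic sequence $(v_0,v_1),(v_1,v_2),\dots,(v_{k-1},v_0)$ of pairwise different directed edges such that for each $i$ the edge $(v_{i+1},v_{i+2})$ follows $(v_{i+1},v_i)$ in the cyclic order around $v_{i+1}$ (indices mod $k$); $k$ is the size of the face. The genus $g$ of an embedded graph with $v$ vertices, $e$ edges and $f$ faces is defined by $v-e+f=2-2g$. The dual $G^*$ of an embedded graph $G$ has the faces of $G$ as vertices and, for every edge of $G$, an edge joining the two faces containing its two directed edges. A $k$-cut of a graph is a set of $k$ vertices whose removal disconnects the graph. For $c\ge k\ge 1$, $\delta_k(c)$ is the minimum $s$ such that there exists a simple $c$-connected embedded graph $G$ of genus $s$ whose dual $G^*$ is a simple graph with a $k$-cut. *)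

theory Defs
  imports
    "Graph_Theory.Graph_Theory"
    "HOL-Combinatorics.Orbits"
    "HOL-Library.Extended_Real"
begin

text \<open>
  Finite undirected graphs are bidirected digraphs: an edge is a pair of mutually inverse arcs
  \<open>a\<close>, \<open>arev a\<close>. Loops and parallel edges are possible. The map \<open>rot\<close> sends an arc to
  its successor in the cyclic order around its tail.
\<close>

locale embedded_graph = fin_digraph G + bidirected_digraph G arev
  for G :: "('a, 'b) pre_digraph" and arev :: "'b \<Rightarrow> 'b" +
  fixes rot :: "'b \<Rightarrow> 'b"
  assumes connected: "Digraph_Component.connected G"
    and rot_permutes: "rot permutes arcs G"
    and rot_cyclic: "\<And>v. v \<in> verts G \<Longrightarrow> out_arcs G v \<noteq> {} \<Longrightarrow> cyclic_on rot (out_arcs G v)"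

definition edges :: "('a, 'b) pre_digraph \<Rightarrow> ('b \<Rightarrow> 'b) \<Rightarrow> 'b set set" where
  "edges G arev = {{a, arev a} | a. a \<in> arcs G}"

definition facial_cycle ::
  "('a, 'b) pre_digraph \<Rightarrow> ('b \<Rightarrow> 'b) \<Rightarrow> ('b \<Rightarrow> 'b) \<Rightarrow> 'b list \<Rightarrow> bool" where
  "facial_cycle G arev rot es \<longleftrightarrow>
     es \<noteq> [] \<and> distinct es \<and> set es \<subseteq> arcs G \<and>
     (\<forall>i < length es. es ! (Suc i mod length es) = rot (arev (es ! i)))"

text \<open>
  Each arc of a facial cycle determines the next one, so the cyclic sequence can be recovered from
  the set of its arcs. The face is represented by this set.
\<close>

definition faces :: "('a, 'b) pre_digraph \<Rightarrow> ('b \<Rightarrow> 'b) \<Rightarrow> ('b \<Rightarrow> 'b) \<Rightarrow> 'b set set" where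
  "faces G arev rot = {set es | es. facial_cycle G arev rot es}"

definition face_of ::
  "('a, 'b) pre_digraph \<Rightarrow> ('b \<Rightarrow> 'b) \<Rightarrow> ('b \<Rightarrow> 'b) \<Rightarrow> 'b \<Rightarrow> 'b set" where
  "face_of G arev rot a = (THE F. F \<in> faces G arev rot \<and> a \<in> F)"

definition has_genus ::
  "('a, 'b) pre_digraph \<Rightarrow> ('b \<Rightarrow> 'b) \<Rightarrow> ('b \<Rightarrow> 'b) \<Rightarrow> nat \<Rightarrow> bool" where
  "has_genus G arev rot g \<longleftrightarrow>
     int (card (verts G)) - int (card (edges G arev)) + int (card (faces G arev rot))
       = 2 - 2 * int g"

definition dual ::
  "('a, 'b) pre_digraph \<Rightarrow> ('b \<Rightarrow> 'b) \<Rightarrow> ('b \<Rightarrow> 'b) \<Rightarrow> ('b set, 'b) pre_digraph" where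
  "dual G arev rot =
     \<lparr> verts = faces G arev rot, arcs = arcs G,
       tail = face_of G arev rot, head = (\<lambda>a. face_of G arev rot (arev a)) \<rparr>"

text \<open>
  The graph without vertices is not connected in the sense of \<^const>\<open>Digraph_Component.connected\<close>;
  a cut has to leave at least one vertex (and hence at least two).
\<close>

definition is_cut :: "('a, 'b) pre_digraph \<Rightarrow> nat \<Rightarrow> 'a set \<Rightarrow> bool" where
  "is_cut G k S \<longleftrightarrow>
     S \<subseteq> verts G \<and> finite S \<and> card S = k \<and> verts G - S \<noteq> {} \<and>
     \<not> Digraph_Component.connected (G \<restriction> (verts G - S))"

definition k_connected :: "nat \<Rightarrow> ('a, 'b) pre_digraph \<Rightarrow> bool" where
  "k_connected c G \<longleftrightarrow> card (verts G) > c \<and> (\<forall>j < c. \<nexists>S. is_cut G j S)"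

text \<open>
  The locale \<open>Digraph.graph\<close> describes finite simple graphs: symmetric, without loops and without
  parallel arcs. As only finite simple \<open>G\<close> are considered, the types of vertices and arcs are no
  restriction. The infimum in \<open>enat\<close> is the minimum if such a graph exists, and \<open>\<infinity>\<close> otherwise.
\<close>

definition delta :: "nat \<Rightarrow> nat \<Rightarrow> enat" where
  "delta k c = Inf {enat s | s.
     \<exists>(G :: (nat, nat \<times> nat) pre_digraph) arev rot.
       embedded_graph G arev rot \<and> Digraph.graph G \<and> k_connected c G \<and> has_genus G arev rot s \<and>
       Digraph.graph (dual G arev rot) \<and> (\<exists>S. is_cut (dual G arev rot) k S)}"

lemma facial_cycle_eq_orbit:
  assumes "facial_cycle G arev rot es" and "a \<in> set es"
  shows "set es = orbit (\<lambda>b. rot (arev b)) a"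
proof -
  let ?f = "\<lambda>b. rot (arev b)" and ?k = "length es"
  have step: "es ! (Suc i mod ?k) = ?f (es ! i)" if "i < ?k" for i
    using assms(1) that by (simp add: facial_cycle_def)
  obtain i where i: "i < ?k" "a = es ! i"
    using assms(2) by (auto simp: in_set_conv_nth)
  have k: "0 < ?k" using i by linarith
  have pow: "es ! ((i + j) mod ?k) = (?f ^^ j) a" for j
  proof (induction j)
    case (Suc j)
    have "es ! (Suc ((i + j) mod ?k) mod ?k) = ?f (es ! ((i + j) mod ?k))"
      using step k by simp
    then show ?case using Suc by (simp add: mod_Suc_eq)
  qed (use i in simp)
  show ?thesis
  proof
    show "set es \<subseteq> orbit ?f a"
    proof
      fix b assume "b \<in> set es"
      then obtain j where j: "j < ?k" "b = es ! j" by (auto simp: in_set_conv_nth)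
      have "(i + (?k - i + j)) mod ?k = j" using i j by simp
      then have "b = (?f ^^ (?k - i + j)) a" using pow[of "?k - i + j"] j by simp
      moreover have "0 < ?k - i + j" using i by simp
      ultimately show "b \<in> orbit ?f a" unfolding orbit_altdef by blast
    qed
    show "orbit ?f a \<subseteq> set es"
    proof
      fix b assume "b \<in> orbit ?f a"
      then obtain j where "b = (?f ^^ j) a" unfolding orbit_altdef by blast
      then show "b \<in> set es" using pow[of j] k by (metis mod_less_divisor nth_mem)
    qed
  qed
qed

lemma (in embedded_graph) orbit_in_faces:
  assumes a: "a \<in> arcs G"
  shows "orbit (\<lambda>b. rot (arev b)) a \<in> faces G arev rot"
proof -
  let ?f = "\<lambda>b. rot (arev b)"
  have perm: "?f permutes arcs G"
    using permutes_compose[OF arev_permutes_arcs rot_permutes] by (simp add: comp_def)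
  then have "permutation ?f" unfolding permutation_permutes using finite_arcs by blast
  then have self: "a \<in> orbit ?f a" by (rule permutation_self_in_orbit)
  let ?n = "funpow_dist1 ?f a a"
  let ?es = "map (\<lambda>i. (?f ^^ i) a) [0..<?n]"
  have ret: "(?f ^^ ?n) a = a" using funpow_dist1_prop[OF self] .
  have inj: "inj_on (\<lambda>i. (?f ^^ i) a) {0..<?n}"
    using inj_on_funpow_dist1[OF self] .
  have "?es ! (Suc i mod ?n) = ?f (?es ! i)" if "i < ?n" for i
  proof (cases "Suc i = ?n")
    case True
    have "?es ! (Suc i mod ?n) = a" using True by (simp del: upt_Suc)
    also have "a = (?f ^^ Suc i) a" using ret True by simp
    also have "\<dots> = ?f (?es ! i)" using that by (simp del: upt_Suc)
    finally show ?thesis .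
  next
    case False
    then have "Suc i < ?n" using that by simp
    then show ?thesis using that by (simp del: upt_Suc)
  qed
  moreover have "(?f ^^ i) a \<in> arcs G" for i
    using a permutes_in_image[OF perm] by (induction i) auto
  ultimately have fc: "facial_cycle G arev rot ?es"
    unfolding facial_cycle_def using inj by (auto simp: distinct_map simp del: upt_Suc)
  have "a \<in> set ?es" by (auto intro!: image_eqI[of _ _ 0] simp del: upt_Suc)
  from facial_cycle_eq_orbit[OF fc this] fc show ?thesis
    unfolding faces_def mem_Collect_eq by (intro exI[of _ ?es] conjI) (simp_all del: upt_Suc)
qed

lemma (in embedded_graph) face_of_eq_orbit:
  assumes "a \<in> arcs G"
  shows "face_of G arev rot a = orbit (\<lambda>b. rot (arev b)) a"
    and "\<exists>!F. F \<in> faces G arev rot \<and> a \<in> F"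
proof -
  have uniq: "F = orbit (\<lambda>b. rot (arev b)) a" if "F \<in> faces G arev rot" "a \<in> F" for F
  proof -
    from that(1) obtain es where "facial_cycle G arev rot es" "F = set es"
      unfolding faces_def by auto
    with that(2) show ?thesis using facial_cycle_eq_orbit[of G arev rot es a] by simp
  qed
  have "(\<lambda>b. rot (arev b)) permutes arcs G"
    using permutes_compose[OF arev_permutes_arcs rot_permutes] by (simp add: comp_def)
  then have "permutation (\<lambda>b. rot (arev b))"
    unfolding permutation_permutes using finite_arcs by blast
  then have self: "a \<in> orbit (\<lambda>b. rot (arev b)) a" by (rule permutation_self_in_orbit)
  have mem: "orbit (\<lambda>b. rot (arev b)) a \<in> faces G arev rot \<and> a \<in> orbit (\<lambda>b. rot (arev b)) a"
    using orbit_in_faces[OF assms] self by (rule conjI)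
  show "face_of G arev rot a = orbit (\<lambda>b. rot (arev b)) a"
    unfolding face_of_def using mem by (rule the_equality) (simp add: uniq)
  show "\<exists>!F. F \<in> faces G arev rot \<and> a \<in> F"
    using mem by (rule ex1I) (simp add: uniq)
qed

end

theory Submission
  imports Defs "HOL-Combinatorics.Cycles"
begin

text \<open>
  For the embedded complete graph on \<open>c + 1\<close> to \<open>c + 3\<close> vertices the bound on the genus holds
  whatever the rotations are, so it suffices to embed it such that the dual is simple and has a cut
  vertex. Take the vertices \<open>0, \<dots>, m - 1\<close> modulo an odd \<open>m = 2 K + 3\<close> and one further vertex, the
  hub. Choose signs such that the differences \<open>d\<^sub>0 = -2\<close>, \<open>d\<^sub>i = \<plusminus> 2 (i + 1)\<close> for \<open>i < K\<close> have sum
  \<open>0\<close> modulo \<open>m\<close>, and let the neighbours of \<open>x\<close> follow one another in the order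
  hub, \<open>x - 1\<close>, \<open>x + d\<^sub>0\<close>, \<open>x - d\<^sub>1\<close>, \<open>x + d\<^sub>1\<close>, \<open>\<dots>\<close>, \<open>x - d\<^bsub>K-1\<^esub>\<close>, \<open>x + d\<^bsub>K-1\<^esub>\<close>, \<open>x - d\<^sub>0\<close>, \<open>x + 1\<close>.
  The faces are triangles around the hub, one face \<open>F\<close> with the differences \<open>1\<close> and \<open>d\<^sub>0\<close>,
  closed walks \<open>C\<^sub>x\<close> with the differences \<open>-d\<^sub>1, \<dots>, -d\<^bsub>K-1\<^esub>, -d\<^sub>0\<close> and faces with constant
  difference \<open>d\<^sub>i\<close>, \<open>0 < i < K\<close>. Each \<open>C\<^sub>x\<close> has one edge in common with \<open>F\<close> and one for each \<open>i\<close>,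
  so the dual is simple. The triangles meet the rest of the dual only in \<open>F\<close>.
\<close>

section \<open>Sign and orbits of a permutation\<close>

lemma sign_cycle_of_list:
  assumes "distinct cs" "cs \<noteq> []"
  shows "sign (cycle_of_list cs) = (-1) ^ (length cs + 1)"
  using assms
proof (induction cs rule: cycle_of_list.induct)
  case (1 i j cs)
  have "sign (cycle_of_list (i # j # cs)) = sign (transpose i j) * sign (cycle_of_list (j # cs))"
    unfolding cycle_of_list.simps by (rule sign_compose[OF permutation_swap_id permutation_of_cycle])
  then show ?case using 1 by (simp add: sign_swap_id del: cycle_of_list.simps)
qed (simp_all flip: id_def)

lemma orbit_cycle_of_list:
  assumes "distinct cs" "x \<in> set cs"
  shows "orbit (cycle_of_list cs) x = set cs"
proof -
  let ?f = "cycle_of_list cs"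
  have ne: "cs \<noteq> []" using assms by auto
  have pow: "(?f ^^ n) (cs ! 0) = cs ! (n mod length cs)" for n
    using arg_cong[OF cyclic_rotation[OF assms(1), of n], of "\<lambda>xs. xs ! 0"] ne
    by (simp add: nth_rotate)
  have "orbit ?f (cs ! 0) = set cs"
  proof
    show "set cs \<subseteq> orbit ?f (cs ! 0)"
    proof
      fix y assume "y \<in> set cs"
      then obtain n where "n < length cs" "y = cs ! n" by (auto simp: in_set_conv_nth)
      then show "y \<in> orbit ?f (cs ! 0)"
        using pow[of n] by (simp add: orbit_altdef_permutation[OF permutation_of_cycle]) metis
    qed
    show "orbit ?f (cs ! 0) \<subseteq> set cs"
      using cycle_permutes ne by (intro permutes_orbit_subset) auto
  qed
  then have "cyclic_on ?f (set cs)"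
    using ne unfolding cyclic_on_def by (intro bexI[of _ "cs ! 0"]) simp_all
  then show ?thesis using assms(2) by (rule orbit_cyclic_eq3)
qed

lemma cycle_decomp_imp_permutes:
  assumes "cycle_decomp I p"
  shows "p permutes I \<and> finite I"
  using assms
proof (induction rule: cycle_decomp.induct)
  case (comp I p cs)
  have "cycle_of_list cs permutes set cs \<union> I" "p permutes set cs \<union> I"
    using comp.IH cycle_permutes[of cs] by (meson permutes_subset Un_upper1 Un_upper2)+
  then show ?case using comp.IH permutes_compose by blast
qed (auto simp: permutes_def)

text \<open>Induction over a decomposition into disjoint cycles, fixed points included: a cycle of
  length \<open>l\<close> has sign \<open>(-1) ^ (l + 1)\<close> and contributes \<open>l\<close>
  elements and one orbit.\<close>

theorem sign_eq_card_orbits: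
  assumes "p permutes S" "finite S"
  shows "sign p = (-1) ^ (card S + card (orbit p ` S))"
proof -
  from assms have "cycle_decomp S p" by (rule cycle_decomposition)
  then show ?thesis
  proof (induction rule: cycle_decomp.induct)
    case (comp I p cs)
    let ?f = "cycle_of_list cs"
    have pI: "p permutes I" "finite I"
      using cycle_decomp_imp_permutes[OF comp.hyps(1)] by simp_all
    show ?case
    proof (cases "cs = []")
      case False
      have perm: "permutation p" "permutation ?f"
        using pI by (simp_all add: permutes_imp_permutation permutation_of_cycle)
      have I: "orbit (?f \<circ> p) x = orbit p x" if "x \<in> I" for x
      proof (rule orbit_cong0[OF that, symmetric])
        show "p \<in> I \<rightarrow> I" using pI permutes_in_image by fastforce
        show "p y = (?f \<circ> p) y" if "y \<in> I" for y
        proof -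
          have "p y \<notin> set cs" using that permutes_in_image[OF pI(1), of y] comp.hyps(3) by auto
          then show ?thesis by (simp add: id_outside_supp)
        qed
      qed
      have cs: "orbit (?f \<circ> p) x = set cs" if "x \<in> set cs" for x
      proof -
        have "orbit ?f x = orbit (?f \<circ> p) x"
        proof (rule orbit_cong0[OF that])
          show "?f \<in> set cs \<rightarrow> set cs" using permutes_in_image[OF cycle_permutes[of cs]] by auto
          show "?f y = (?f \<circ> p) y" if "y \<in> set cs" for y
          proof -
            have "p y = y" using that comp.hyps(3) by (intro permutes_not_in[OF pI(1)]) auto
            then show ?thesis by simp
          qed
        qed
        then show ?thesis using orbit_cycle_of_list[OF comp.hyps(2) that] by simp
      qed
      have "orbit (?f \<circ> p) ` (set cs \<union> I) = insert (set cs) (orbit p ` I)"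
      proof -
        have "orbit (?f \<circ> p) ` set cs = {set cs}"
          using False cs by (simp add: image_constant_conv cong: image_cong)
        moreover have "orbit (?f \<circ> p) ` I = orbit p ` I" using I by (simp cong: image_cong)
        ultimately show ?thesis by (simp add: image_Un)
      qed
      moreover have "set cs \<notin> orbit p ` I"
      proof
        assume "set cs \<in> orbit p ` I"
        then obtain x where "x \<in> I" "set cs = orbit p x" by auto
        then show False using permutation_self_in_orbit[OF perm(1), of x] comp.hyps(3) by auto
      qed
      ultimately have "card (orbit (?f \<circ> p) ` (set cs \<union> I)) = Suc (card (orbit p ` I))"
        using pI by simp
      moreover have "card (set cs \<union> I) = length cs + card I"
        using comp.hyps pI by (simp add: card_Un_disjoint distinct_card)
      moreover have "sign (?f \<circ> p) = (-1) ^ (length cs + 1) * (-1) ^ (card I + card (orbit p ` I))"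
        unfolding sign_compose[OF perm(2,1)] sign_cycle_of_list[OF comp.hyps(2) False] comp.IH ..
      ultimately show ?thesis by (simp only: flip: power_add) (simp add: ac_simps)
    qed (use comp.IH in simp)
  qed simp
qed

lemma cyclic_on_Suc_mod:
  assumes "0 < n"
  shows "cyclic_on (\<lambda>p. Suc p mod n) {..<n}"
proof -
  let ?f = "\<lambda>p. Suc p mod n"
  have pow: "(?f ^^ k) 0 = k mod n" for k by (induction k) (simp_all add: mod_Suc_eq)
  have "orbit ?f 0 = {..<n}"
  proof
    show "orbit ?f 0 \<subseteq> {..<n}"
      using assms by (auto simp: orbit_altdef pow)
    show "{..<n} \<subseteq> orbit ?f 0"
    proof
      fix k assume "k \<in> {..<n}"
      \<comment> \<open>\<open>orbit\<close> consists of positive powers only; the exponent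
        \<open>k + n\<close> also covers \<open>k = 0\<close>.\<close>
      then have "k = (?f ^^ (k + n)) 0" using pow[of "k + n"] by simp
      then show "k \<in> orbit ?f 0" unfolding orbit_altdef using assms by blast
    qed
  qed
  then show ?thesis using assms by (auto simp: cyclic_on_def intro!: bexI[of _ 0])
qed

lemma card_mult_le_of_disjoint:
  assumes "finite S" "\<And>A. A \<in> P \<Longrightarrow> A \<subseteq> S" "\<And>A. A \<in> P \<Longrightarrow> k \<le> card A"
    and "\<And>A B. A \<in> P \<Longrightarrow> B \<in> P \<Longrightarrow> A \<noteq> B \<Longrightarrow> A \<inter> B = {}"
  shows "k * card P \<le> card S"
proof -
  have fin: "finite P" using assms(1,2) by (meson finite_Pow_iff PowI finite_subset subsetI)
  have "k * card P = (\<Sum>A\<in>P. k)" by simp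
  also have "\<dots> \<le> (\<Sum>A\<in>P. card A)" using assms(3) by (intro sum_mono) auto
  also have "\<dots> = card (\<Union>P)"
    using assms fin by (intro card_Union_disjoint[symmetric])
      (auto simp: pairwise_def disjnt_def intro: finite_subset)
  also have "\<dots> \<le> card S" using assms(1,2) by (intro card_mono) auto
  finally show ?thesis .
qed

section \<open>Face labellings of embedded graphs\<close>

lemma connected_if_complete:
  assumes "verts H \<noteq> {}"
    and "\<And>u v. u \<in> verts H \<Longrightarrow> v \<in> verts H \<Longrightarrow> u \<noteq> v \<Longrightarrow> (u, v) \<in> arcs_ends H"
  shows "Digraph_Component.connected H"
  unfolding connected_conv
proof (intro conjI ballI)
  fix u v assume uv: "u \<in> verts H" "v \<in> verts H"
  show "(u, v) \<in> rtrancl_on (verts H) ((arcs_ends H)\<^sup>s)"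
  proof (cases "u = v")
    case False
    then have "(u, v) \<in> (arcs_ends H)\<^sup>s" using assms(2) uv by (auto simp: symcl_def)
    then show ?thesis using uv by (meson rtrancl_on_refl rtrancl_on_into_rtrancl_on)
  qed (use uv in simp)
qed (use assms in simp)

lemma not_connected_if_separated:
  assumes "u \<in> verts H" "v \<in> verts H" "P u" "\<not> P v"
    and sep: "\<And>a. a \<in> arcs H \<Longrightarrow> P (tail H a) \<longleftrightarrow> P (head H a)"
  shows "\<not> Digraph_Component.connected H"
proof
  assume "Digraph_Component.connected H"
  then have "(u, v) \<in> rtrancl_on (verts H) ((arcs_ends H)\<^sup>s)"
    using assms by (auto simp: connected_conv)
  then have "P v"
  proof (induction rule: rtrancl_on_induct)
    case (step y z)
    then show ?case using sep by (auto simp: symcl_def arcs_ends_conv)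
  qed (rule assms(3))
  with assms show False by simp
qed

context embedded_graph
begin

abbreviation face_succ :: "'b \<Rightarrow> 'b" where
  "face_succ \<equiv> \<lambda>b. rot (arev b)"

lemma face_succ_permutes: "face_succ permutes arcs G"
  using permutes_compose[OF arev_permutes_arcs rot_permutes] by (simp add: comp_def)

lemma permutation_face_succ: "permutation face_succ"
  using finite_arcs face_succ_permutes by (rule permutes_imp_permutation)

lemma faces_eq: "faces G arev rot = orbit face_succ ` arcs G"
proof
  show "faces G arev rot \<subseteq> orbit face_succ ` arcs G"
  proof
    fix F assume "F \<in> faces G arev rot"
    then obtain es where es: "facial_cycle G arev rot es" "F = set es" by (auto simp: faces_def)
    then have "hd es \<in> set es" "set es \<subseteq> arcs G" by (auto simp: facial_cycle_def)
    then show "F \<in> orbit face_succ ` arcs G"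
      using facial_cycle_eq_orbit[OF es(1), of "hd es"] es(2) by auto
  qed
qed (auto intro: orbit_in_faces)

lemma face_of_in_faces: "a \<in> arcs G \<Longrightarrow> face_of G arev rot a \<in> faces G arev rot"
  by (simp add: face_of_eq_orbit(1) orbit_in_faces)

lemma self_in_face_of: "a \<in> arcs G \<Longrightarrow> a \<in> face_of G arev rot a"
  by (simp add: face_of_eq_orbit(1) permutation_self_in_orbit[OF permutation_face_succ])

lemma face_of_eqI:
  assumes "a \<in> arcs G" "b \<in> orbit face_succ a"
  shows "face_of G arev rot b = face_of G arev rot a"
proof -
  have "b \<in> arcs G" using permutes_orbit_subset[OF face_succ_permutes] assms by blast
  then show ?thesis
    using orbit_cyclic_eq3[OF cyclic_on_orbit'[OF permutation_face_succ] assms(2)] assms(1)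
    by (simp add: face_of_eq_orbit(1))
qed

text \<open>An invariant of the face successor is constant on each face. Different labels thus prove
  faces different without computing orbits.\<close>

lemma face_of_eq_imp_label_eq:
  assumes lab: "\<And>a. a \<in> arcs G \<Longrightarrow> lab (face_succ a) = lab a"
    and ab: "a \<in> arcs G" "b \<in> arcs G" "face_of G arev rot a = face_of G arev rot b"
  shows "lab a = lab b"
proof -
  have "b \<in> orbit face_succ a"
    using self_in_face_of[OF ab(2)] ab by (simp add: face_of_eq_orbit(1))
  then have "b \<in> arcs G \<and> lab b = lab a"
  proof induction
    case base
    then show ?case using ab lab permutes_in_image[OF face_succ_permutes] by auto
  next
    case (step y)
    then show ?case using lab permutes_in_image[OF face_succ_permutes] by auto
  qed
  then show ?thesis by simp
qed

lemma card_arcs: "card (arcs G) = 2 * card (edges G arev)"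
proof -
  have "card (\<Union>(edges G arev)) = (\<Sum>A\<in>edges G arev. card A)"
  proof (rule card_Union_disjoint)
    have "{a, arev a} = {b, arev b}" if "{a, arev a} \<inter> {b, arev b} \<noteq> {}" for a b
      using that by (auto simp: insert_commute arev_eq_iff)
    then show "pairwise disjnt (edges G arev)"
      unfolding edges_def pairwise_def disjnt_def by blast
  qed (auto simp: edges_def)
  also have "\<dots> = (\<Sum>A\<in>edges G arev. 2)"
    using arev_neq by (intro sum.cong) (force simp: edges_def card_insert_if)+
  finally have "card (\<Union>(edges G arev)) = 2 * card (edges G arev)" by simp
  moreover have "\<Union>(edges G arev) = arcs G" by (auto simp: edges_def)
  ultimately show ?thesis by simp
qed

text \<open>
  Here \<open>rot\<close>, \<open>arev\<close> and their composition have the vertices, edges and faces as orbits, and the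
  number of orbits of a permutation determines its sign.
\<close>

theorem euler_characteristic_even:
  assumes "\<And>v. v \<in> verts G \<Longrightarrow> out_arcs G v \<noteq> {}"
  shows "even (card (verts G) + card (edges G arev) + card (faces G arev rot))"
proof -
  have perm: "permutation rot" "permutation arev"
    using rot_permutes arev_permutes_arcs by (simp_all add: permutes_imp_permutation[OF finite_arcs])
  have "orbit rot ` arcs G = out_arcs G ` verts G"
  proof -
    have "orbit rot a = out_arcs G (tail G a)" if "a \<in> arcs G" for a
      using that assms by (intro orbit_cyclic_eq3 rot_cyclic) auto
    moreover have "\<exists>a \<in> arcs G. tail G a = v" if "v \<in> verts G" for v
      using assms[OF that] by auto
    ultimately show ?thesis by (fastforce simp: image_iff)
  qed
  moreover have "inj_on (out_arcs G) (verts G)"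
    using assms by (intro inj_onI) (metis in_out_arcs_conv ex_in_conv)
  ultimately have V: "card (orbit rot ` arcs G) = card (verts G)"
    by (simp add: card_image)
  have "orbit arev a = {a, arev a}" for a
  proof
    show "orbit arev a \<subseteq> {a, arev a}"
    proof
      fix b assume "b \<in> orbit arev a"
      then show "b \<in> {a, arev a}" by induction auto
    qed
    show "{a, arev a} \<subseteq> orbit arev a"
      using orbit.base[of arev a] orbit.step[OF orbit.base[of arev a]] by simp
  qed
  then have E: "orbit arev ` arcs G = edges G arev"
    by (auto simp: edges_def)
  have "sign face_succ = sign rot * sign arev"
    using sign_compose[OF perm] by (simp add: comp_def)
  then have "(-1::int) ^ (card (arcs G) + card (faces G arev rot)) =
    (-1) ^ (card (arcs G) + card (verts G)) * (-1) ^ (card (arcs G) + card (edges G arev))"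
    using sign_eq_card_orbits[OF rot_permutes finite_arcs]
      sign_eq_card_orbits[OF arev_permutes_arcs finite_arcs]
      sign_eq_card_orbits[OF face_succ_permutes finite_arcs]
    by (simp add: V E faces_eq)
  then have "even (card (arcs G) + card (verts G) + card (edges G arev) + card (faces G arev rot))"
    by (simp flip: power_add add: minus_one_power_iff split: if_splits)
  then show ?thesis by (auto simp: card_arcs)
qed

text \<open>Several faces may share a label. Identifying them would turn loops and parallel arcs of
  the dual into loops and parallel arcs again, so it is enough to exclude these at the level of
  labels.\<close>

lemma graph_dual_if_labelled:
  assumes lab: "\<And>a. a \<in> arcs G \<Longrightarrow> lab (face_succ a) = lab a"
    and loopfree: "\<And>a. a \<in> arcs G \<Longrightarrow> lab a \<noteq> lab (arev a)"
    and inj: "\<And>a b. a \<in> arcs G \<Longrightarrow> b \<in> arcs G \<Longrightarrow> lab a = lab b \<Longrightarrow>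
      lab (arev a) = lab (arev b) \<Longrightarrow> a = b"
  shows "Digraph.graph (dual G arev rot)"
proof
  note eqD = face_of_eq_imp_label_eq[where lab = lab, OF lab]
  show "finite (verts (dual G arev rot))" by (simp add: dual_def faces_eq)
  show "tail (dual G arev rot) a \<noteq> head (dual G arev rot) a" if "a \<in> arcs (dual G arev rot)" for a
    using that loopfree[of a] eqD[of a "arev a"] by (auto simp: dual_def)
  show "a = b" if "a \<in> arcs (dual G arev rot)" "b \<in> arcs (dual G arev rot)"
    "arc_to_ends (dual G arev rot) a = arc_to_ends (dual G arev rot) b" for a b
    using that inj[of a b] eqD[of a b] eqD[of "arev a" "arev b"]
    by (auto simp: dual_def arc_to_ends_def)
  show "symmetric (dual G arev rot)"
    unfolding symmetric_conv by (auto simp: dual_def intro!: bexI[of _ "arev _"])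
qed (simp_all add: dual_def face_of_in_faces)

text \<open>The second assumption on \<open>f\<close> says that its label belongs to a single face,
  so deleting this face leaves exactly the faces with other labels. Along the remaining arcs
  \<open>P\<close> does not change, and the faces of \<open>b\<close> and \<open>c\<close> lie on
  different sides.\<close>

lemma is_cut_dual_if_labelled:
  assumes lab: "\<And>a. a \<in> arcs G \<Longrightarrow> lab (face_succ a) = lab a"
    and f: "f \<in> arcs G" "\<And>a. a \<in> arcs G \<Longrightarrow> lab a = lab f \<Longrightarrow> a \<in> orbit face_succ f"
    and sep: "\<And>a. a \<in> arcs G \<Longrightarrow> lab a \<noteq> lab f \<Longrightarrow> lab (arev a) \<noteq> lab f \<Longrightarrow>
      P (lab a) \<longleftrightarrow> P (lab (arev a))"
    and b: "b \<in> arcs G" "lab b \<noteq> lab f" "P (lab b)"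
    and c: "c \<in> arcs G" "lab c \<noteq> lab f" "\<not> P (lab c)"
  shows "is_cut (dual G arev rot) 1 {face_of G arev rot f}"
proof -
  let ?D = "dual G arev rot" and ?face = "face_of G arev rot"
  let ?P = "\<lambda>F. \<exists>a \<in> arcs G. F = ?face a \<and> P (lab a)"
  note eqD = face_of_eq_imp_label_eq[where lab = lab, OF lab]
  have P: "?P (?face a) \<longleftrightarrow> P (lab a)" if "a \<in> arcs G" for a
    using that eqD[of a] by metis
  have ne: "?face a \<noteq> ?face f \<longleftrightarrow> lab a \<noteq> lab f" if "a \<in> arcs G" for a
    using that eqD[of a f] face_of_eqI[OF f(1), of a] f by metis
  have "\<not> Digraph_Component.connected (?D \<restriction> (verts ?D - {?face f}))"
  proof (rule not_connected_if_separated[where P = ?P and u = "?face b" and v = "?face c"])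
    show "?P (tail (?D \<restriction> (verts ?D - {?face f})) a) \<longleftrightarrow> ?P (head (?D \<restriction> (verts ?D - {?face f})) a)"
      if "a \<in> arcs (?D \<restriction> (verts ?D - {?face f}))" for a
    proof -
      have a: "a \<in> arcs G" "?face a \<noteq> ?face f" "?face (arev a) \<noteq> ?face f"
        using that by (auto simp: dual_def)
      then have "P (lab a) \<longleftrightarrow> P (lab (arev a))" using sep[of a] ne[of a] ne[of "arev a"] by simp
      then show ?thesis using P[of a] P[of "arev a"] a(1) by (simp add: dual_def)
    qed
  qed (use b c P ne in \<open>simp_all add: dual_def face_of_in_faces\<close>)
  moreover have "?face b \<in> verts ?D - {?face f}" "?face f \<in> verts ?D"
    using b ne f by (simp_all add: dual_def face_of_in_faces)
  ultimately show ?thesis by (auto simp: is_cut_def)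
qed

end

section \<open>Rotation systems of complete graphs\<close>

definition complete_arcs :: "nat \<Rightarrow> (nat \<times> nat) set" where
  "complete_arcs n = {(u, v). u \<le> n \<and> v \<le> n \<and> u \<noteq> v}"

text \<open>There are \<open>n + 1\<close> vertices, so that \<open>n\<close> is the degree and the
  number of positions in each rotation.\<close>

definition complete_graph :: "nat \<Rightarrow> (nat, nat \<times> nat) pre_digraph" where
  "complete_graph n = \<lparr> verts = {..n}, arcs = complete_arcs n, tail = fst, head = snd \<rparr>"

text \<open>The identity outside the arcs, because in a \<open>bidirected_digraph\<close> the
  reversal moves precisely the arcs.\<close>

definition complete_rev :: "nat \<Rightarrow> nat \<times> nat \<Rightarrow> nat \<times> nat" where
  "complete_rev n a = (if a \<in> complete_arcs n then prod.swap a else a)"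

lemma complete_graph_simps [simp]:
  "verts (complete_graph n) = {..n}" "arcs (complete_graph n) = complete_arcs n"
  "tail (complete_graph n) = fst" "head (complete_graph n) = snd"
  by (simp_all add: complete_graph_def)

lemma finite_complete_arcs [simp]: "finite (complete_arcs n)"
  by (rule finite_subset[of _ "{..n} \<times> {..n}"]) (auto simp: complete_arcs_def)

lemma card_complete_arcs: "card (complete_arcs n) = n * (n + 1)"
proof -
  have "complete_arcs n = (SIGMA u:{..n}. {..n} - {u})" by (auto simp: complete_arcs_def)
  then show ?thesis by (simp add: card_SigmaI)
qed

lemma graph_complete_graph: "Digraph.graph (complete_graph n)"
  by unfold_locales
    (simp_all, auto simp: complete_arcs_def arc_to_ends_def symmetric_conv)

text \<open>Every nonempty induced subgraph is complete and hence connected, so there is no cut of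
  any size.\<close>

lemma k_connected_complete_graph:
  assumes "c \<le> n"
  shows "k_connected c (complete_graph n)"
proof -
  have "Digraph_Component.connected (complete_graph n \<restriction> V)" if "V \<noteq> {}" "V \<subseteq> {..n}" for V
    using that by (intro connected_if_complete) (force simp: arcs_ends_conv complete_arcs_def)+
  then have "\<not> is_cut (complete_graph n) j S" for j S
    unfolding is_cut_def by (metis Diff_subset complete_graph_simps(1))
  then show ?thesis using assms by (simp add: k_connected_def)
qed

text \<open>The rotation at \<open>v\<close> is \<open>nb v 0, nb v 1, \<dots>, nb v (n - 1)\<close>.\<close>

locale complete_rotation =
  fixes n :: nat and nb :: "nat \<Rightarrow> nat \<Rightarrow> nat"
  assumes two_le_n: "2 \<le> n"
    and nb_bij: "\<And>v. v \<le> n \<Longrightarrow> bij_betw (nb v) {..<n} ({..n} - {v})"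
begin

text \<open>\<open>inv_into\<close> recovers the position of an arc in the rotation at its tail.
  Outside the arcs the map is the identity, as \<open>permutes\<close> demands.\<close>

definition rot :: "nat \<times> nat \<Rightarrow> nat \<times> nat" where
  "rot a = (if a \<in> complete_arcs n
     then (fst a, nb (fst a) (Suc (inv_into {..<n} (nb (fst a)) (snd a)) mod n)) else a)"

lemma nb_in_arcs: "v \<le> n \<Longrightarrow> p < n \<Longrightarrow> (v, nb v p) \<in> complete_arcs n"
  using bij_betwE[OF nb_bij] by (fastforce simp: complete_arcs_def)

lemma rot_nb: "v \<le> n \<Longrightarrow> p < n \<Longrightarrow> rot (v, nb v p) = (v, nb v (Suc p mod n))"
  using nb_in_arcs bij_betw_inv_into_left[OF nb_bij] by (simp add: rot_def)

lemma nb_eq_iff: "v \<le> n \<Longrightarrow> p < n \<Longrightarrow> q < n \<Longrightarrow> nb v p = nb v q \<longleftrightarrow> p = q"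
  using bij_betw_imp_inj_on[OF nb_bij] by (auto simp: inj_on_def)

lemma arc_cases:
  assumes "a \<in> complete_arcs n"
  obtains v p where "v \<le> n" "p < n" "a = (v, nb v p)"
proof -
  obtain v u where a: "a = (v, u)" "v \<le> n" "u \<in> {..n} - {v}"
    using assms by (auto simp: complete_arcs_def)
  then show thesis using that bij_betw_imp_surj_on[OF nb_bij[OF a(2)]] by blast
qed

sublocale embedded_graph "complete_graph n" "complete_rev n" rot
proof -
  have out: "out_arcs (complete_graph n) v = (\<lambda>p. (v, nb v p)) ` {..<n}" if "v \<le> n" for v
    using that by (auto simp: out_arcs_def nb_in_arcs elim!: arc_cases)
  interpret Digraph.graph "complete_graph n" by (rule graph_complete_graph)
  show "embedded_graph (complete_graph n) (complete_rev n) rot"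
  proof
    show "a \<in> arcs (complete_graph n) \<longleftrightarrow> complete_rev n a \<noteq> a" for a
      by (cases a) (auto simp: complete_rev_def complete_arcs_def)
    show "complete_rev n (complete_rev n a) = a" if "a \<in> arcs (complete_graph n)" for a
      using that by (cases a) (auto simp: complete_rev_def complete_arcs_def)
    show "tail (complete_graph n) (complete_rev n a) = head (complete_graph n) a"
      if "a \<in> arcs (complete_graph n)" for a
      using that by (simp add: complete_rev_def)
    show "Digraph_Component.connected (complete_graph n)"
      by (rule connected_if_complete) (force simp: arcs_ends_conv complete_arcs_def)+
    show "cyclic_on rot (out_arcs (complete_graph n) v)" if "v \<in> verts (complete_graph n)" for v
      using that two_le_n
      by (simp add: out) (intro cyclic_on_image[OF cyclic_on_Suc_mod], auto simp: rot_nb)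
    have "inj_on rot (complete_arcs n)"
    proof (rule inj_onI)
      fix a b assume ab: "a \<in> complete_arcs n" "b \<in> complete_arcs n" "rot a = rot b"
      obtain v p w q where *: "v \<le> n" "p < n" "a = (v, nb v p)" "w \<le> n" "q < n" "b = (w, nb w q)"
        using ab(1,2) by (metis arc_cases)
      then have "w = v" "Suc p mod n = Suc q mod n" using ab(3) two_le_n by (auto simp: rot_nb nb_eq_iff)
      then show "a = b" using * by (auto simp: mod_Suc split: if_splits)
    qed
    moreover have "rot ` complete_arcs n \<subseteq> complete_arcs n"
      by (auto elim!: arc_cases simp: rot_nb nb_in_arcs)
    ultimately have "bij_betw rot (complete_arcs n) (complete_arcs n)"
      by (simp add: bij_betw_def endo_inj_surj)
    then show "rot permutes arcs (complete_graph n)"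
      by (intro bij_imp_permutes) (simp_all add: rot_def)
  qed
qed

section \<open>Face sizes and genus of a rotation of the complete graph\<close>

lemma face_succ_nb:
  assumes "v \<le> n" "p < n" "nb v p = u"
  shows "face_succ (u, v) = (v, nb v (Suc p mod n))"
proof -
  have "(u, v) \<in> complete_arcs n" using nb_in_arcs[OF assms(1,2)] assms(3)
    by (auto simp: complete_arcs_def)
  then show ?thesis using rot_nb[OF assms(1,2)] assms(3) by (simp add: complete_rev_def)
qed

text \<open>A face never turns straight back, since each rotation has at least two
  positions.\<close>

lemma face_succ_ends:
  assumes "(u, v) \<in> complete_arcs n"
  obtains w where "face_succ (u, v) = (v, w)" "(v, w) \<in> complete_arcs n" "w \<noteq> u"
proof -
  have "(v, u) \<in> complete_arcs n" using assms by (auto simp: complete_arcs_def)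
  then obtain p where p: "v \<le> n" "p < n" "nb v p = u" by (elim arc_cases) auto
  moreover have "Suc p mod n \<noteq> p" using p(2) two_le_n by (cases "Suc p = n") auto
  ultimately show thesis
    using that[of "nb v (Suc p mod n)"] face_succ_nb nb_in_arcs[of v "Suc p mod n"]
      nb_eq_iff[of v "Suc p mod n" p] by auto
qed

text \<open>Three consecutive arcs of a face differ, because their tails \<open>u\<close>,
  \<open>v\<close>, \<open>w\<close> are pairwise different.\<close>

lemma three_le_card_face:
  assumes "F \<in> faces (complete_graph n) (complete_rev n) rot"
  shows "3 \<le> card F"
proof -
  obtain u v where uv: "(u, v) \<in> complete_arcs n" "F = orbit face_succ (u, v)"
    using assms by (auto simp: faces_eq)
  obtain w where w: "face_succ (u, v) = (v, w)" "(v, w) \<in> complete_arcs n" "w \<noteq> u"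
    using uv(1) by (rule face_succ_ends)
  obtain x where x: "face_succ (v, w) = (w, x)"
    using w(2) by (rule face_succ_ends)
  have "(u, v) \<in> F" unfolding uv by (rule permutation_self_in_orbit[OF permutation_face_succ])
  moreover have "(v, w) \<in> F" using orbit.base[of face_succ "(u, v)"] w(1) uv(2) by simp
  moreover have "(w, x) \<in> F" using orbit.step[of "(v, w)" face_succ "(u, v)"] x calculation uv(2) by simp
  ultimately have sub: "{(u, v), (v, w), (w, x)} \<subseteq> F" by simp
  have "F \<subseteq> complete_arcs n"
    using permutes_orbit_subset[OF face_succ_permutes] uv by simp
  then have "finite F" using finite_subset finite_complete_arcs by blast
  moreover have "card {(u, v), (v, w), (w, x)} = 3"
    using uv w by (auto simp: complete_arcs_def)
  ultimately show ?thesis using card_mono[OF _ sub] by simp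
qed

text \<open>\<open>has_genus\<close> asks for a natural number: parity of the Euler characteristic
  makes the genus an integer, and the face size of at least three makes it nonnegative. The upper
  bound is Euler's formula with the number of faces estimated by \<open>0\<close>, so it holds for
  every rotation.\<close>

lemma has_genus_le:
  assumes "6 \<le> n"
  obtains g where "has_genus (complete_graph n) (complete_rev n) rot g"
    and "4 * int g \<le> int n ^ 2 - int n + 2"
proof -
  let ?F = "faces (complete_graph n) (complete_rev n) rot"
  let ?E = "edges (complete_graph n) (complete_rev n)"
  have E: "2 * card ?E = n * (n + 1)"
    using card_arcs by (simp add: card_complete_arcs)
  have "3 * card ?F \<le> card (complete_arcs n)"
  proof (rule card_mult_le_of_disjoint)
    show "A \<inter> B = {}" if AB: "A \<in> ?F" "B \<in> ?F" "A \<noteq> B" for A B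
    proof (rule ccontr)
      assume "A \<inter> B \<noteq> {}"
      then obtain a where a: "a \<in> A" "a \<in> B" by auto
      obtain b where "A = orbit face_succ b" "b \<in> complete_arcs n" using AB(1) unfolding faces_eq by auto
      then have "a \<in> complete_arcs n"
        using a(1) permutes_orbit_subset[OF face_succ_permutes, of b] by auto
      then show False using face_of_eq_orbit(2)[of a] a AB by auto
    qed
    show "A \<subseteq> complete_arcs n" if "A \<in> ?F" for A
      using that permutes_orbit_subset[OF face_succ_permutes] by (auto simp: faces_eq)
  qed (simp_all add: three_le_card_face)
  then have "int (3 * card ?F) \<le> int (n * (n + 1))"
    by (simp only: of_nat_le_iff card_complete_arcs)
  then have F: "3 * int (card ?F) \<le> int n * (int n + 1)" by (simp add: algebra_simps)
  have "out_arcs (complete_graph n) v \<noteq> {}" if "v \<le> n" for v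
    using nb_in_arcs[OF that, of 0] two_le_n by (auto simp: out_arcs_def)
  then have "even (card {..n} + card ?E + card ?F)"
    using euler_characteristic_even by simp
  then have "even (int (card ?E) + 1 - int n - int (card ?F))" by simp presburger
  then obtain h where h: "int (card ?E) + 1 - int n - int (card ?F) = 2 * h" by (elim evenE)
  have E': "2 * int (card ?E) = int n * (int n + 1)"
    using E by (metis of_nat_1 of_nat_add of_nat_mult of_nat_numeral)
  \<comment> \<open>With \<open>e\<close> edges and \<open>f\<close> faces, \<open>f\<close> is at
    most \<open>2 e / 3\<close> and \<open>e / 3\<close> is at least \<open>n + 1\<close>, whence
    \<open>e + 1 - n - f\<close> is at least \<open>2\<close>.\<close>
  have "int n * (int n + 1) \<ge> 6 * (int n + 1)"
    using assms by (intro mult_right_mono) auto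
  moreover have "0 \<le> h"
    if "6 * (k + 1) \<le> 2 * e" "e + 1 - k - f = 2 * h" "3 * f \<le> 2 * e" for e f k :: int
    using that by presburger
  ultimately have "h \<ge> 0" using h F unfolding E'[symmetric] by blast
  show thesis
  proof (rule that[of "nat h"])
    show "has_genus (complete_graph n) (complete_rev n) rot (nat h)"
      using h \<open>h \<ge> 0\<close> by (simp add: has_genus_def)
    show "4 * int (nat h) \<le> int n ^ 2 - int n + 2"
      using h E' \<open>h \<ge> 0\<close> by (simp add: power2_eq_square algebra_simps)
  qed
qed

end

section \<open>The embedding with a cut vertex in the dual\<close>

text \<open>
  The value \<open>d K = d 0\<close> serves the cyclic indexing: position \<open>2 i + 1\<close> of the rotation has
  difference \<open>- d i\<close> for all \<open>0 < i \<le> K\<close>.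
\<close>

locale difference_signs =
  fixes K :: nat and d :: "nat \<Rightarrow> int"
  assumes three_le_K: "3 \<le> K"
    and d_0: "d 0 = -2" and d_K: "d K = -2"
    and d_cases: "\<And>i. 0 < i \<Longrightarrow> i < K \<Longrightarrow> d i = 2 * (int i + 1) \<or> d i = - 2 * (int i + 1)"
    and sum_d: "int (2 * K + 3) dvd (\<Sum>i<K. d i)"
begin

definition m :: nat where "m = 2 * K + 3"

definition shift :: "nat \<Rightarrow> int \<Rightarrow> nat" where
  "shift x z = nat ((int x + z) mod int m)"

text \<open>The hub takes position \<open>0\<close>. The differences \<open>-1\<close> and
  \<open>1\<close> stand on both sides of it; in between, \<open>- d i\<close> has position
  \<open>2 i + 1\<close> and \<open>d i\<close> has position \<open>2 i + 2\<close>.\<close>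

definition diff :: "nat \<Rightarrow> int" where
  "diff p = (if p = 1 then -1 else if p = 2 * K + 2 then 1
     else if odd p then - d (p div 2) else d (p div 2 - 1))"

text \<open>The natural order at the hub fits the neighbours \<open>x + 1\<close>, hub,
  \<open>x - 1\<close> in the rotation at \<open>x\<close>, so that the faces at the hub become
  triangles.\<close>

definition nb :: "nat \<Rightarrow> nat \<Rightarrow> nat" where
  "nb x p = (if x = m then p else if p = 0 then m else shift x (diff p))"

lemma m_gt: "9 \<le> m" using three_le_K by (simp add: m_def)

lemma shift_less [simp]: "shift x z < m"
  using m_gt by (simp add: shift_def nat_less_iff)

lemma shift_neq_m [simp]: "shift x z \<noteq> m" "m \<noteq> shift x z"
  using shift_less[of x z] by linarith+

lemma int_shift: "int (shift x z) = (int x + z) mod int m"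
  using m_gt by (simp add: shift_def)

lemma shift_shift [simp]: "shift (shift x z) w = shift x (z + w)"
  unfolding shift_def[of "shift x z"] shift_def[of x "z + w"] int_shift
  by (simp add: mod_add_left_eq add.assoc)

lemma shift_0 [simp]: "x < m \<Longrightarrow> shift x 0 = x"
  by (simp add: shift_def)

lemma shift_eqI: "int m dvd z - w \<Longrightarrow> shift x z = shift x w"
  unfolding shift_def by (metis add_diff_cancel_left mod_eq_dvd_iff)

lemma diff_simps:
  "diff (Suc 0) = -1" "diff (2 * K + 2) = 1" "diff 2 = -2" "diff (2 * K + 1) = 2"
  "0 < i \<Longrightarrow> i < K \<Longrightarrow> diff (2 * i + 2) = d i" "0 < i \<Longrightarrow> i \<le> K \<Longrightarrow> diff (2 * i + 1) = - d i"
  using three_le_K by (auto simp: diff_def d_0 d_K)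

text \<open>As \<open>m\<close> is odd, one of \<open>z\<close> and \<open>m - z\<close> is even and
  hence equal to \<open>2 (i + 1)\<close> with \<open>i \<le> K\<close>. For
  \<open>0 < i < K\<close> both signs occur as \<open>d i\<close> and \<open>- d i\<close>, whatever
  sign \<open>d i\<close> has. The value for \<open>i = K\<close> is \<open>-1\<close> modulo
  \<open>m\<close>, and \<open>i = 0\<close> gives the differences \<open>2\<close> and
  \<open>-2\<close>.\<close>

lemma diff_surj:
  assumes "0 < z" "z < int m"
  obtains p where "0 < p" "p < m" "int m dvd diff p - z"
proof -
  have i: "\<exists>i. y = 2 * (int i + 1) \<and> i \<le> K" if "even y" "0 < y" "y < int m" for y
  proof -
    obtain k where "y = 2 * k" using \<open>even y\<close> by (elim evenE)
    then show ?thesis using that by (intro exI[of _ "nat (k - 1)"]) (auto simp: m_def)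
  qed
  show thesis
  proof (cases "even z")
    case True
    then obtain i where i: "z = 2 * (int i + 1)" "i \<le> K" using i assms by blast
    consider "i = 0" | "i = K" | "0 < i" "i < K" using i(2) by linarith
    then show thesis
    proof cases
      case 1
      then show thesis using that[of "2 * K + 1"] i diff_simps(4) by (simp add: m_def)
    next
      case 2
      then have "diff 1 - z = - int m" using i diff_simps(1) by (simp add: m_def)
      then show thesis using that[of 1] m_gt by simp
    next
      case 3
      with i d_cases[of i] consider "d i = z" | "d i = - z" by force
      then show thesis
        using that[of "2 * i + 2"] that[of "2 * i + 1"] diff_simps(5,6)[of i] 3
        by cases (simp_all add: m_def)
    qed
  next
    case False
    then obtain i where i: "int m - z = 2 * (int i + 1)" "i \<le> K"
      using i[of "int m - z"] assms by (auto simp: m_def)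
    consider "i = 0" | "i = K" | "0 < i" "i < K" using i(2) by linarith
    then show thesis
    proof cases
      case 2
      then show thesis using that[of "2 * K + 2"] i diff_simps(2) by (simp add: m_def)
    next
      case 1
      then have "diff 2 - z = - int m" using i diff_simps(3) by simp
      then show thesis using that[of 2] m_gt by simp
    next
      case 3
      with i d_cases[of i] consider "d i = int m - z" | "d i = z - int m" by force
      then have "diff (2 * i + 1) - z = - int m \<or> diff (2 * i + 2) - z = - int m"
        using diff_simps(5,6)[of i] 3 by cases simp_all
      moreover have "2 * i + 2 < m" using 3 by (simp add: m_def)
      ultimately show thesis using that[of "2 * i + 2"] that[of "2 * i + 1"] by auto
    qed
  qed
qed

sublocale complete_rotation m nb
proof
  show "2 \<le> m" using m_gt by simp
  fix v assume "v \<le> m"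
  show "bij_betw (nb v) {..<m} ({..m} - {v})"
  proof (cases "v = m")
    case False
    with \<open>v \<le> m\<close> have v: "v < m" by simp
    \<comment> \<open>Surjectivity suffices, as both sets have \<open>m\<close> elements.\<close>
    have sub: "{..m} - {v} \<subseteq> nb v ` {..<m}"
    proof
      fix u assume u: "u \<in> {..m} - {v}"
      show "u \<in> nb v ` {..<m}"
      proof (cases "u = m")
        case True
        then show ?thesis using v by (intro image_eqI[of _ _ 0]) (auto simp: nb_def)
      next
        case False
        let ?z = "(int u - int v) mod int m"
        have "\<not> int m dvd int u - int v"
          using u v False by (auto simp: mod_eq_dvd_iff[symmetric])
        then have "?z \<noteq> 0" by auto
        then have "0 < ?z" using m_gt by (simp add: order_neq_le_trans)
        moreover have "?z < int m" using m_gt by simp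
        ultimately obtain p where p: "0 < p" "p < m" "int m dvd diff p - ?z" by (rule diff_surj)
        have "shift v (diff p) = shift v ?z" by (rule shift_eqI[OF p(3)])
        also have "\<dots> = u" using u False by (simp add: shift_def mod_add_right_eq)
        finally show ?thesis using p v by (intro image_eqI[of _ _ p]) (auto simp: nb_def)
      qed
    qed
    have card: "card ({..m} - {v}) = card {..<m}" using \<open>v \<le> m\<close> by simp
    have "card (nb v ` {..<m}) \<le> card ({..m} - {v})" unfolding card by (rule card_image_le) simp
    then have "nb v ` {..<m} = {..m} - {v}" using card_seteq[OF _ sub] by simp
    then show ?thesis using card eq_card_imp_inj_on[of "{..<m}" "nb v"] by (simp add: bij_betw_def)
  qed (auto simp: nb_def bij_betw_def inj_on_def)
qed

section \<open>The faces and their labels\<close>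

text \<open>After a step with difference \<open>z\<close>, the way back has difference
  \<open>- z\<close>; if this stands at position \<open>p\<close>, the next difference is
  \<open>diff (p + 1)\<close>. The first three equations give the triangles, the next two
  \<open>F\<close>, the next two the walks \<open>C\<^sub>x\<close>, and the last one the faces with
  constant difference.\<close>

lemma face_succ_simps:
  assumes "x < m"
  shows "face_succ (m, x) = (x, shift x (-1))"
    and "face_succ (x, m) = (m, shift x 1)"
    and "face_succ (x, shift x (-1)) = (shift x (-1), m)"
    and "face_succ (x, shift x 1) = (shift x 1, shift x (-1))"
    and "face_succ (x, shift x (-2)) = (shift x (-2), shift x (-1))"
    and "0 < i \<Longrightarrow> i < K \<Longrightarrow> face_succ (x, shift x (- d i)) =
      (shift x (- d i), shift x (- d i - d (Suc i)))"
    and "face_succ (x, shift x (- d K)) = (shift x (- d K), shift x (- d K - d 1))"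
    and "0 < i \<Longrightarrow> i < K \<Longrightarrow> face_succ (x, shift x (d i)) = (shift x (d i), shift x (d i + d i))"
proof -
  have step: "face_succ (x, shift x z) = (shift x z, shift x (z + diff (Suc p)))"
    if "0 < p" "Suc p < m" "diff p = - z" for p z
    using face_succ_nb[of "shift x z" p x] that assms by (simp add: nb_def less_imp_le)
  show "face_succ (m, x) = (x, shift x (-1))"
    using face_succ_nb[of x 0 m] assms m_gt by (simp add: nb_def diff_simps)
  show "face_succ (x, m) = (m, shift x 1)"
    using face_succ_nb[of m x x] assms m_gt
    by (simp add: nb_def shift_def nat_mod_distrib nat_add_distrib)
  have "Suc (2 * K + 2) = m" by (simp add: m_def)
  then show "face_succ (x, shift x (-1)) = (shift x (-1), m)"
    using face_succ_nb[of "shift x (-1)" "2 * K + 2" x] diff_simps(2) assms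
    by (simp add: nb_def less_imp_le)
  show "face_succ (x, shift x 1) = (shift x 1, shift x (-1))"
    using step[of 1 1] m_gt diff_simps(1,3) by (simp flip: numeral_2_eq_2)
  show "face_succ (x, shift x (-2)) = (shift x (-2), shift x (-1))"
    using step[of "2 * K + 1" "-2"] diff_simps(2,4) by (simp add: m_def)
  show "face_succ (x, shift x (- d i)) = (shift x (- d i), shift x (- d i - d (Suc i)))"
    if "0 < i" "i < K"
    using step[of "2 * i + 2" "- d i"] diff_simps(5)[of i] diff_simps(6)[of "Suc i"] that
    by (auto simp: m_def intro!: arg_cong[of _ _ "shift x"])
  show "face_succ (x, shift x (- d K)) = (shift x (- d K), shift x (- d K - d 1))"
    using step[of 2 "- d K"] diff_simps(3) diff_simps(6)[of 1] m_gt three_le_K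
    by (simp add: d_K numeral_3_eq_3)
  show "face_succ (x, shift x (d i)) = (shift x (d i), shift x (d i + d i))"
    if "0 < i" "i < K"
    using step[of "2 * i + 1" "d i"] diff_simps(5,6)[of i] that
    by (simp add: m_def)
qed

text \<open>
  The first component tells the kind of the face: triangle at the hub, \<open>F\<close>, \<open>C\<^sub>x\<close> or constant
  difference. The partial sum makes the second component constant along \<open>C\<^sub>x\<close>.
\<close>

definition lab :: "nat \<times> nat \<Rightarrow> nat \<times> nat" where
  "lab a = (let x = fst a; p = inv_into {..<m} (nb x) (snd a) in
     if x = m then (0, snd a) else if p = 0 then (0, shift x 1) else if p = 1 then (0, x)
     else if p = 2 \<or> p = 2 * K + 2 then (1, 0)
     else if odd p then (2, shift x (\<Sum>j = 1..<p div 2. d j)) else (3, p div 2 - 1))"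

lemma lab_simps:
  assumes "x < m"
  shows "lab (m, x) = (0, x)"
    and "lab (x, m) = (0, shift x 1)"
    and "lab (x, shift x (-1)) = (0, x)"
    and "lab (x, shift x 1) = (1, 0)"
    and "lab (x, shift x (-2)) = (1, 0)"
    and "0 < i \<Longrightarrow> i \<le> K \<Longrightarrow> lab (x, shift x (- d i)) = (2, shift x (\<Sum>j = 1..<i. d j))"
    and "0 < i \<Longrightarrow> i < K \<Longrightarrow> lab (x, shift x (d i)) = (3, i)"
proof -
  have inv: "inv_into {..<m} (nb x) (nb x p) = p" if "p < m" for p
    using bij_betw_inv_into_left[OF nb_bij] assms that by simp
  have pos: "inv_into {..<m} (nb x) (shift x z) = p" if "0 < p" "p < m" "diff p = z" for p z
    using inv[of p] that assms by (simp add: nb_def)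
  show "lab (m, x) = (0, x)" by (simp add: lab_def)
  show "lab (x, m) = (0, shift x 1)" using inv[of 0] assms m_gt by (simp add: lab_def nb_def)
  show "lab (x, shift x (-1)) = (0, x)"
    using pos[of 1 "-1"] assms m_gt diff_simps(1) by (simp add: lab_def)
  show "lab (x, shift x 1) = (1, 0)"
    using pos[of "2 * K + 2" 1] assms three_le_K diff_simps(2) by (simp add: lab_def m_def)
  show "lab (x, shift x (-2)) = (1, 0)"
    using pos[of 2 "-2"] assms m_gt diff_simps(3) by (simp add: lab_def)
  show "lab (x, shift x (- d i)) = (2, shift x (\<Sum>j = 1..<i. d j))" if "0 < i" "i \<le> K"
  proof -
    have "inv_into {..<m} (nb x) (shift x (- d i)) = 2 * i + 1"
      using that diff_simps(6)[of i] by (intro pos) (simp_all add: m_def)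
    moreover have "2 * i + 1 \<noteq> 2" "2 * i + 1 \<noteq> 2 * K + 2" by presburger+
    ultimately show ?thesis using assms that by (simp add: lab_def)
  qed
  show "lab (x, shift x (d i)) = (3, i)" if "0 < i" "i < K"
  proof -
    have "inv_into {..<m} (nb x) (shift x (d i)) = 2 * i + 2"
      using that diff_simps(5)[of i] by (intro pos) (simp_all add: m_def)
    then show ?thesis using assms that by (simp add: lab_def)
  qed
qed

text \<open>The difference \<open>2 = - d K\<close> is a case of its own: it closes the walks
  \<open>C\<^sub>x\<close>, and its reverse lies on \<open>F\<close>.\<close>

lemma arc_kinds:
  assumes "a \<in> complete_arcs m"
  obtains (from_hub) x where "x < m" "a = (m, x)"
  | (to_hub) x where "x < m" "a = (x, m)"
  | (minus_one) x where "x < m" "a = (x, shift x (-1))"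
  | (one) x where "x < m" "a = (x, shift x 1)"
  | (minus_two) x where "x < m" "a = (x, shift x (-2))"
  | (two) x where "x < m" "a = (x, shift x (- d K))"
  | (minus_d) x i where "x < m" "0 < i" "i < K" "a = (x, shift x (- d i))"
  | (plus_d) x i where "x < m" "0 < i" "i < K" "a = (x, shift x (d i))"
proof -
  obtain x p where xp: "x \<le> m" "p < m" "a = (x, nb x p)" using assms by (rule arc_cases)
  show thesis
  proof (cases "x = m \<or> p = 0")
    case True
    then show thesis using xp that(1)[of p] that(2)[of x] by (cases "x = m") (simp_all add: nb_def)
  next
    case False
    then have x: "x < m" and a: "a = (x, shift x (diff p))" using xp by (auto simp: nb_def)
    have "\<exists>i. p = 2 * i + 1 \<and> i \<le> K + 1 \<or> p = 2 * i + 2 \<and> i \<le> K"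
      using False xp(2) unfolding m_def by presburger
    then obtain i where i: "p = 2 * i + 1 \<and> i \<le> K + 1 \<or> p = 2 * i + 2 \<and> i \<le> K" ..
    consider "p = 1" | "p = 2 * K + 2" | "p = 2" | "p = 2 * K + 1"
      | "0 < i" "i < K" "p = 2 * i + 1" | "0 < i" "i < K" "p = 2 * i + 2"
      using i xp(2) by (fastforce simp: m_def)
    then show thesis
    proof cases
      case 1 then show thesis using that(3) x a diff_simps(1) by simp
    next
      case 2 then show thesis using that(4) x a diff_simps(2) by simp
    next
      case 3 then show thesis using that(5) x a diff_simps(3) by simp
    next
      case 4 then show thesis using that(6) x a diff_simps(4) d_K by simp
    next
      case 5 then show thesis using that(7) x a diff_simps(6) by simp
    next
      case 6 then show thesis using that(8) x a diff_simps(5) by simp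
    qed
  qed
qed

lemma lab_face_succ:
  assumes "a \<in> complete_arcs m"
  shows "lab (face_succ a) = lab a"
  using assms
proof (cases rule: arc_kinds)
  case (from_hub x)
  then show ?thesis by (simp add: face_succ_simps lab_simps)
next
  case (to_hub x)
  then show ?thesis by (simp add: face_succ_simps lab_simps)
next
  case (minus_one x)
  then show ?thesis using lab_simps(2)[of "shift x (-1)"] by (simp add: face_succ_simps lab_simps)
next
  case (one x)
  then show ?thesis using lab_simps(5)[of "shift x 1"] by (simp add: face_succ_simps lab_simps)
next
  case (minus_two x)
  then show ?thesis using lab_simps(4)[of "shift x (-2)"] by (simp add: face_succ_simps lab_simps)
next
  case (two x)
  \<comment> \<open>Here \<open>C\<^sub>x\<close> closes up. As \<open>d K = d 0\<close>, the
    difference is the sum of all \<open>d i\<close>, which \<open>m\<close> divides.\<close>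
  have "int m dvd (\<Sum>j = 1..<K. d j) - (- d K)"
  proof -
    have "{..<K} = insert 0 {1..<K}" using three_le_K by auto
    then show ?thesis using sum_d by (simp add: d_0 d_K m_def)
  qed
  then have "shift x (\<Sum>j = 1..<K. d j) = shift x (- d K)" by (rule shift_eqI)
  then show ?thesis
    using two lab_simps(6)[of "shift x (- d K)" 1] three_le_K
    by (simp add: face_succ_simps lab_simps)
next
  case (minus_d x i)
  then show ?thesis using lab_simps(6)[of "shift x (- d i)" "Suc i"]
    by (simp add: face_succ_simps lab_simps)
next
  case (plus_d x i)
  then show ?thesis using lab_simps(7)[of "shift x (d i)" i]
    by (simp add: face_succ_simps lab_simps)
qed

section \<open>Simplicity of the dual and its cut vertex\<close>

lemma complete_rev_simps:
  assumes "x < m"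
  shows "complete_rev m (m, x) = (x, m)" "complete_rev m (x, m) = (m, x)"
    "shift x z \<noteq> x \<Longrightarrow> complete_rev m (x, shift x z) = (shift x z, shift (shift x z) (- z))"
  using assms by (simp_all add: complete_rev_def complete_arcs_def less_imp_le)

text \<open>Read together with \<open>lab_simps\<close>, this is the list of adjacencies in the
  dual. The membership assumptions exclude \<open>shift x z = x\<close>, where
  \<open>complete_rev\<close> is the identity.\<close>

lemma lab_rev_simps:
  assumes "x < m"
  shows "lab (complete_rev m (m, x)) = (0, shift x 1)"
    and "lab (complete_rev m (x, m)) = (0, x)"
    and "(x, shift x (-1)) \<in> complete_arcs m \<Longrightarrow> lab (complete_rev m (x, shift x (-1))) = (1, 0)"
    and "(x, shift x 1) \<in> complete_arcs m \<Longrightarrow> lab (complete_rev m (x, shift x 1)) = (0, shift x 1)"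
    and "(x, shift x (-2)) \<in> complete_arcs m \<Longrightarrow>
      lab (complete_rev m (x, shift x (-2))) = (2, shift x (-2 + (\<Sum>j = 1..<K. d j)))"
    and "(x, shift x (- d K)) \<in> complete_arcs m \<Longrightarrow>
      lab (complete_rev m (x, shift x (- d K))) = (1, 0)"
    and "(x, shift x (- d i)) \<in> complete_arcs m \<Longrightarrow> 0 < i \<Longrightarrow> i < K \<Longrightarrow>
      lab (complete_rev m (x, shift x (- d i))) = (3, i)"
    and "(x, shift x (d i)) \<in> complete_arcs m \<Longrightarrow> 0 < i \<Longrightarrow> i < K \<Longrightarrow>
      lab (complete_rev m (x, shift x (d i))) = (2, shift x (d i + (\<Sum>j = 1..<i. d j)))"
proof -
  note s = complete_rev_simps[OF assms] lab_simps[OF assms]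
  have ne: "shift x z \<noteq> x" if "(x, shift x z) \<in> complete_arcs m" for z
    using that by (auto simp: complete_arcs_def)
  note rev = complete_rev_simps(3)[OF assms ne]
  show "lab (complete_rev m (m, x)) = (0, shift x 1)" "lab (complete_rev m (x, m)) = (0, x)"
    by (simp_all add: s)
  show "lab (complete_rev m (x, shift x (-1))) = (1, 0)" if "(x, shift x (-1)) \<in> complete_arcs m"
    using rev[OF that] lab_simps(4)[of "shift x (-1)"] by simp
  show "lab (complete_rev m (x, shift x 1)) = (0, shift x 1)" if "(x, shift x 1) \<in> complete_arcs m"
    using rev[OF that] lab_simps(3)[of "shift x 1"] by simp
  show "lab (complete_rev m (x, shift x (-2))) = (2, shift x (-2 + (\<Sum>j = 1..<K. d j)))"
    if "(x, shift x (-2)) \<in> complete_arcs m"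
    using rev[OF that] lab_simps(6)[of "shift x (-2)" K] three_le_K by (simp add: d_K)
  show "lab (complete_rev m (x, shift x (- d K))) = (1, 0)"
    if "(x, shift x (- d K)) \<in> complete_arcs m"
    using rev[OF that] lab_simps(5)[of "shift x (- d K)"] by (simp add: d_K)
  show "lab (complete_rev m (x, shift x (- d i))) = (3, i)"
    if "(x, shift x (- d i)) \<in> complete_arcs m" "0 < i" "i < K"
    using rev[OF that(1)] lab_simps(7)[of "shift x (- d i)" i] that by simp
  show "lab (complete_rev m (x, shift x (d i))) = (2, shift x (d i + (\<Sum>j = 1..<i. d j)))"
    if "(x, shift x (d i)) \<in> complete_arcs m" "0 < i" "i < K"
    using rev[OF that(1)] lab_simps(6)[of "shift x (d i)" i] that by simp
qed

lemma shift_neq_self: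
  assumes "x < m" "0 < z" "z < int m"
  shows "shift x z \<noteq> x"
proof
  assume "shift x z = x"
  then have "(int x + z) mod int m = int x mod int m" using int_shift[of x z] assms(1) by simp
  then have "int m dvd z" by (simp add: mod_eq_dvd_iff)
  then show False using assms(2,3) by (simp add: zdvd_not_zless)
qed

text \<open>The kinds of the two faces differ except for the edges at the hub, which separate the
  triangles \<open>x\<close> and \<open>x + 1\<close>.\<close>

lemma lab_neq_lab_rev:
  assumes "a \<in> complete_arcs m"
  shows "lab a \<noteq> lab (complete_rev m a)"
  using assms
proof (cases rule: arc_kinds)
  case (from_hub x)
  then show ?thesis using shift_neq_self[of x 1] m_gt by (simp add: lab_simps lab_rev_simps)
next
  case (to_hub x)
  then show ?thesis using shift_neq_self[of x 1] m_gt by (simp add: lab_simps lab_rev_simps)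
qed (use assms three_le_K in \<open>simp_all add: lab_simps lab_rev_simps\<close>)

text \<open>An explicit left inverse of the map from an arc to the labels on its two sides; it shows
  that the dual has no parallel arcs. On pairs of labels that do not come from an arc its value is
  irrelevant.\<close>

definition arc_of_labels :: "nat \<times> nat \<Rightarrow> nat \<times> nat \<Rightarrow> nat \<times> nat" where
  "arc_of_labels l l' = (let i = snd l; j = snd l' in
     if fst l = 0 then
       if fst l' = 0 then if j = shift i 1 then (m, i) else (j, m)
       else (i, shift i (-1))
     else if fst l = 1 then
       if fst l' = 0 then (shift j (-1), j)
       else (shift j (2 - (\<Sum>k = 1..<K. d k)), shift j (- (\<Sum>k = 1..<K. d k)))
     else if fst l = 2 then
       if fst l' = 1 then (shift i (- (\<Sum>k = 1..<K. d k)), shift i (- (\<Sum>k = 1..<K. d k) - d K))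
       else (shift i (- (\<Sum>k = 1..<j. d k)), shift i (- (\<Sum>k = 1..<j. d k) - d j))
     else (shift j (- d i - (\<Sum>k = 1..<i. d k)), shift j (- (\<Sum>k = 1..<i. d k))))"

lemma arc_of_labels_lab:
  assumes "a \<in> complete_arcs m"
  shows "arc_of_labels (lab a) (lab (complete_rev m a)) = a"
  using assms
proof (cases rule: arc_kinds)
  \<comment> \<open>An arc to the hub has the triangles \<open>x + 1\<close>, \<open>x\<close> on
    its sides, an arc from the hub \<open>x\<close>, \<open>x + 1\<close>. They are told apart
    because \<open>x + 2\<close> differs from \<open>x\<close> modulo \<open>m\<close>.\<close>
  case (to_hub x)
  then show ?thesis using shift_neq_self[of x 2] m_gt
    by (simp add: arc_of_labels_def lab_simps lab_rev_simps)
qed (use assms three_le_K in \<open>simp_all add: arc_of_labels_def lab_simps lab_rev_simps\<close>)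

lemma shift_in_arcs: "x < m \<Longrightarrow> 0 < z \<Longrightarrow> z < int m \<Longrightarrow> (x, shift x z) \<in> complete_arcs m"
  using shift_neq_self[of x z] by (simp add: complete_arcs_def less_imp_le)

text \<open>Two steps along \<open>F\<close>, with differences \<open>-2\<close> and
  \<open>1\<close>, take the arc from \<open>y\<close> to \<open>y + 1\<close> to the arc from
  \<open>y - 1\<close> to \<open>y\<close>. So \<open>F\<close> passes through all arcs with
  difference \<open>1\<close>.\<close>

lemma one_arcs_in_orbit:
  assumes "x < m"
  shows "(x, shift x 1) \<in> orbit face_succ (0, shift 0 1)"
proof -
  have "(shift 0 (- int k), shift 0 (1 - int k)) \<in> orbit face_succ (0, shift 0 1)" for k
  proof (induction k)
    case 0
    then show ?case using permutation_self_in_orbit[OF permutation_face_succ] m_gt by simp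
  next
    case (Suc k)
    let ?y = "shift 0 (- int k)"
    have *: "shift 0 (- int (Suc k)) = shift ?y (-1)" "shift 0 (1 - int (Suc k)) = shift ?y 0"
      unfolding shift_shift by (rule arg_cong[of _ _ "shift 0"], simp)+
    have "face_succ (face_succ (?y, shift 0 (1 - int k))) = (shift ?y (-1), shift ?y 0)"
      using face_succ_simps(4)[of ?y] face_succ_simps(5)[of "shift ?y 1"]
        minus_diff_commute[of 1 "int k"] by simp
    then show ?case unfolding * using orbit.step[OF orbit.step[OF Suc.IH]] by metis
  qed
  \<comment> \<open>Going back \<open>m - x\<close> times from \<open>0\<close> ends at
    \<open>x\<close> modulo \<open>m\<close>.\<close>
  from this[of "m - x"] have
    "(shift 0 (int x - int m), shift 0 (int x - int m + 1)) \<in> orbit face_succ (0, shift 0 1)"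
    using assms by (simp add: of_nat_diff algebra_simps)
  moreover have "shift 0 (int x - int m) = shift 0 (int x)" by (rule shift_eqI) simp
  moreover have "shift 0 (int x - int m + 1) = shift 0 (int x + 1)" by (rule shift_eqI) simp
  moreover have "shift 0 (int x) = x" "shift 0 (int x + 1) = shift x 1"
    using assms by (simp_all add: shift_def)
  ultimately show ?thesis by simp
qed

text \<open>This makes \<open>F\<close> a single face. Each arc with difference \<open>-2\<close>
  directly follows an arc with difference \<open>1\<close>.\<close>

lemma outer_face:
  assumes "a \<in> complete_arcs m" "lab a = (1, 0)"
  shows "a \<in> orbit face_succ (0, shift 0 1)"
  using assms(1)
proof (cases rule: arc_kinds)
  case (one x)
  then show ?thesis by (simp add: one_arcs_in_orbit)
next
  case (minus_two x)
  let ?y = "shift x (-1)"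
  have "face_succ (?y, shift ?y 1) \<in> orbit face_succ (0, shift 0 1)"
    by (rule orbit.step) (rule one_arcs_in_orbit, simp)
  then show ?thesis using minus_two face_succ_simps(4)[of ?y] by simp
qed (use assms three_le_K in \<open>simp_all add: lab_simps\<close>)

theorem graph_dual: "Digraph.graph (dual (complete_graph m) (complete_rev m) rot)"
  by (rule graph_dual_if_labelled[of lab])
    (simp_all add: lab_face_succ lab_neq_lab_rev, metis arc_of_labels_lab)

theorem is_cut_dual:
  "is_cut (dual (complete_graph m) (complete_rev m) rot) 1
     {face_of (complete_graph m) (complete_rev m) rot (0, shift 0 1)}"
\<comment> \<open>\<open>P\<close> singles out the triangles at the hub; \<open>b\<close> lies on
  one of them and \<open>c\<close> on a walk \<open>C\<^sub>x\<close>.\<close>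
proof (rule is_cut_dual_if_labelled[where lab = lab and P = "\<lambda>l. fst l = 0"
      and b = "(m, 0)" and c = "(0, shift 0 (- d K))"])
  have lab0: "lab (0, shift 0 1) = (1, 0)" using m_gt by (simp add: lab_simps)
  show "(0, shift 0 1) \<in> arcs (complete_graph m)" using shift_in_arcs[of 0 1] m_gt by simp
  show "(m, 0) \<in> arcs (complete_graph m)" using m_gt by (simp add: complete_arcs_def)
  show "(0, shift 0 (- d K)) \<in> arcs (complete_graph m)"
    using shift_in_arcs[of 0 2] m_gt by (simp add: d_K)
  show "lab (m, 0) \<noteq> lab (0, shift 0 1)" "fst (lab (m, 0)) = 0"
    "lab (0, shift 0 (- d K)) \<noteq> lab (0, shift 0 1)" "fst (lab (0, shift 0 (- d K))) \<noteq> 0"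
    using m_gt three_le_K by (simp_all add: lab_simps)
  show "a \<in> orbit face_succ (0, shift 0 1)"
    if "a \<in> arcs (complete_graph m)" "lab a = lab (0, shift 0 1)" for a
    using that outer_face lab0 by simp
  show "fst (lab a) = 0 \<longleftrightarrow> fst (lab (complete_rev m a)) = 0"
    if "a \<in> arcs (complete_graph m)" "lab a \<noteq> lab (0, shift 0 1)"
      "lab (complete_rev m a) \<noteq> lab (0, shift 0 1)" for a
  proof -
    from that(1) have a: "a \<in> complete_arcs m" by simp
    then show ?thesis
      by (cases rule: arc_kinds)
        (use a that(2,3) lab0 three_le_K in \<open>simp_all add: lab_simps lab_rev_simps\<close>)
  qed
qed (simp_all add: lab_face_succ)

end

section \<open>Choice of the signs\<close>

text \<open>Greedy choice: if \<open>t\<close> is too large for \<open>{1..n}\<close>, then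
  \<open>Suc n\<close> is taken, and \<open>t - Suc n\<close> is small enough for
  \<open>{1..n}\<close>.\<close>

lemma subset_sum:
  fixes t n :: nat
  assumes "2 * t \<le> n * (n + 1)"
  shows "\<exists>S \<subseteq> {1..n}. \<Sum>S = t"
  using assms
proof (induction n arbitrary: t)
  case (Suc n)
  show ?case
  proof (cases "2 * t \<le> n * (n + 1)")
    case True
    then obtain S where "S \<subseteq> {1..n}" "\<Sum>S = t" using Suc.IH by blast
    then show ?thesis by (intro exI[of _ S]) auto
  next
    case False
    have "2 * n \<le> n * (n + 1)" by (cases n) auto
    with False have t: "n < t" by linarith
    have "2 * (t - Suc n) \<le> n * (n + 1)" using Suc.prems by (simp add: algebra_simps)
    then obtain S where S: "S \<subseteq> {1..n}" "\<Sum>S = t - Suc n" using Suc.IH by blast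
    then have "finite S" "Suc n \<notin> S" by (auto intro: finite_subset)
    then show ?thesis using S t by (intro exI[of _ "insert (Suc n) S"]) auto
  qed
qed auto

text \<open>
  If \<open>1 + \<dots> + K\<close> is even, some signed sum of \<open>1, \<dots>, K\<close> is \<open>0\<close>; otherwise some signed sum is \<open>m\<close>.
\<close>

lemma ex_difference_signs:
  assumes "3 \<le> K"
  shows "\<exists>d. difference_signs K d"
proof -
  let ?m = "2 * K + 3"
  \<comment> \<open>\<open>t\<close> is to be the sum of the numbers that receive a minus sign,
    which changes the sum of \<open>1, ..., K\<close> by \<open>- 2 t\<close>.\<close>
  obtain t :: nat where t: "4 * t \<le> K * (K + 1)"
    "int ?m dvd int (K * (K + 1)) div 2 - 2 * int t"
  proof -
    obtain T where T: "K * (K + 1) = 2 * T" by (metis dvdE even_mult_iff even_plus_one_iff)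
    then have half: "int (K * (K + 1)) div 2 = int T" by simp
    show thesis
    proof (cases "even T")
      case True
      then obtain t where "T = 2 * t" by (elim evenE)
      then show thesis using that[of t] T unfolding half by simp
    next
      case False
      \<comment> \<open>For \<open>K = 3\<close> and \<open>K = 4\<close> the sum \<open>T\<close>
        is \<open>6\<close> and \<open>10\<close>, thus even; from \<open>K = 5\<close> on
        \<open>T\<close> is at least \<open>m\<close>. Since \<open>m\<close> is odd,
        \<open>T - m\<close> is even.\<close>
      have "K \<noteq> 3" "K \<noteq> 4" using T False by auto
      then have "5 * (K + 1) \<le> K * (K + 1)" using assms by (intro mult_right_mono) auto
      then have le: "?m \<le> T" unfolding T using assms by presburger
      with False have "even (T - ?m)" by simp
      then obtain t where "T - ?m = 2 * t" by (elim evenE)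
      with le have "T = ?m + 2 * t" by linarith
      then show thesis using that[of t] T unfolding half by simp
    qed
  qed
  obtain S where S: "S \<subseteq> {1..K}" "\<Sum>S = t" using subset_sum[of t K] t(1) by auto
  define e :: "nat \<Rightarrow> int" where "e j = (if j \<in> S then - int j else int j)" for j
  \<comment> \<open>The factor \<open>e 1\<close> normalises the sign such that
    \<open>d 0 = -2\<close>; it affects the whole sum only by a sign.\<close>
  define d where "d i = (if i = K then -2 else - 2 * e 1 * e (Suc i))" for i
  have e1: "e 1 * e 1 = 1" "e 1 = 1 \<or> e 1 = -1" by (auto simp: e_def)
  have "(\<Sum>j = 1..K. e j) = (\<Sum>j = 1..K. int j) - 2 * (\<Sum>j\<in>S. int j)"
  proof -
    have "(\<Sum>j = 1..K. e j) = (\<Sum>j = 1..K. int j - 2 * (if j \<in> S then int j else 0))"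
      by (intro sum.cong) (auto simp: e_def)
    also have "\<dots> = (\<Sum>j = 1..K. int j) - 2 * (\<Sum>j = 1..K. if j \<in> S then int j else 0)"
      by (simp add: sum_subtractf sum_distrib_left)
    also have "(\<Sum>j = 1..K. if j \<in> S then int j else 0) = (\<Sum>j\<in>S. int j)"
      using S(1) by (simp add: sum.If_cases Int_absorb1)
    finally show ?thesis .
  qed
  also have "(\<Sum>j = 1..K. int j) = int (K * (K + 1)) div 2"
    using gauss_sum_from_Suc_0[of K, where 'a = int] by (simp add: algebra_simps)
  also have "(\<Sum>j\<in>S. int j) = int t" using S(2) by (simp flip: of_nat_sum)
  finally have dvd: "int ?m dvd (\<Sum>j = 1..K. e j)" using t(2) by simp
  have "(\<Sum>i<K. d i) = (\<Sum>i<K. - 2 * e 1 * e (Suc i))" by (intro sum.cong) (auto simp: d_def)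
  also have "\<dots> = - 2 * e 1 * (\<Sum>i<K. e (Suc i))" by (simp add: sum_distrib_left)
  also have "(\<Sum>i<K. e (Suc i)) = (\<Sum>j = 1..K. e j)"
    by (simp add: lessThan_atLeast0 atLeastLessThanSuc_atLeastAtMost flip: sum.shift_bounds_Suc_ivl)
  finally have sum: "int ?m dvd (\<Sum>i<K. d i)" using dvd by simp
  show ?thesis
  proof (intro exI[of _ d] difference_signs.intro)
    show "d 0 = -2" using assms e1 by (simp add: d_def mult.assoc)
    show "d i = 2 * (int i + 1) \<or> d i = - 2 * (int i + 1)" if "0 < i" "i < K" for i
      using that e1(2) by (auto simp: d_def e_def[of "Suc i"])
  qed (use assms sum in \<open>simp_all add: d_def\<close>)
qed

section \<open>The bound on \<open>delta\<close>\<close>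

theorem theorem1:
  fixes c :: nat
  assumes "c \<ge> 7"
  shows "ereal_of_enat (delta 1 c) \<le> ereal ((real c ^ 2 + 6 * real c - 5) / 4)"
proof -
  \<comment> \<open>Then \<open>m\<close> is the least odd number that is at least \<open>c\<close>
    and at least \<open>9\<close>; it equals \<open>c + 2\<close> only for
    \<open>c = 7\<close>.\<close>
  define K where "K = max 3 ((c - 2) div 2)"
  have K: "3 \<le> K" "c \<le> 2 * K + 3" "2 * K + 3 \<le> c + 2" using assms by (auto simp: K_def)
  obtain d where "difference_signs K d" using ex_difference_signs[OF K(1)] by blast
  then interpret difference_signs K d .
  obtain g where g: "has_genus (complete_graph m) (complete_rev m) rot g"
    "4 * int g \<le> int m ^ 2 - int m + 2"
    using has_genus_le m_gt by auto
  have m: "c \<le> m" "m \<le> c + 2" using K by (simp_all add: m_def)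
  have "delta 1 c \<le> enat g"
    unfolding delta_def
    using embedded_graph_axioms graph_complete_graph k_connected_complete_graph[OF m(1)] g(1)
      graph_dual is_cut_dual
    by (intro Inf_lower) blast
  then have "ereal_of_enat (delta 1 c) \<le> ereal (real g)"
    by (metis ereal_of_enat_le_iff ereal_of_enat_simps(1))
  also have "real g \<le> (real c ^ 2 + 6 * real c - 5) / 4"
  proof -
    \<comment> \<open>The claimed \<open>c^2 + 6 c - 5\<close> exceeds
      \<open>(c + 2) (c + 1) + 2\<close> by \<open>3 c - 9\<close>.\<close>
    have "int m * (int m - 1) \<le> (int c + 2) * (int c + 1)"
      using m m_gt by (intro mult_mono) auto
    then have "4 * int g \<le> int c ^ 2 + 6 * int c - 5"
      using g(2) assms by (simp add: power2_eq_square algebra_simps)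
    then have "4 * real g \<le> real c ^ 2 + 6 * real c - 5"
      by (metis (mono_tags, lifting) of_int_le_iff of_int_of_nat_eq of_int_mult of_int_numeral
          of_int_diff of_int_add of_int_power)
    then show ?thesis by simp
  qed
  finally show ?thesis by simp
qed

end
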